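(* Let $\tau$ be a finite relational vocabulary, $\mathcal{Q}$ a finite set of generalized quantifiers of width $1$ and type $(1)$, and $d\in\mathbb{N}$. Assume (induction hypothesis for $d$) that for all $\tau$-models $\mathfrak{A}',\mathfrak{B}'$ and all assignments $f',g'$ over $\mathfrak{A}'$ and $\mathfrak{B}'$ with $\mathrm{dom}(f')=\mathrm{dom}(g')$, Player $\mathbb{I}$ has a winning strategy in the $\mathrm{EF}_d\{\mathcal{Q}\}(\mathfrak{A}',\mathfrak{B}',f',g')$-game if and only if $(\mathfrak{A}',f')$ and $(\mathfrak{B}',g')$ are separable in $\mathrm{FO}(\mathcal{Q})^d$. Let $\mathfrak{A},\mathfrak{B}$ be $\tau$-models and $f,g$ assignments over them with $\mathrm{dom}(f)=\mathrm{dom}(g)$. If $(\mathfrak{A},f)$ and $(\mathfrak{B},g)$ are separable in $\mathrm{FO}(\mathcal{Q})^{d+1}$, then Player $\mathbb{I}$ has a winning strategy in the $\mathrm{EF}_{d+1}\{\mathcal{Q}\}(\mathfrak{A},\mathfrak{B},f,g)$-game.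
   Context: **Logic.** $\tau$ is a finite set of relation symbols with arities in $\mathbb{N}$. A $\tau$-model $\mathfrak{A}$ has a non-empty, possibly infinite domain $A$ and a relation $R^{\mathfrak{A}}\subseteq A^k$ for each $k$-ary $R\in\tau$. $\mathrm{VAR}$ is a countably infinite set of variables. An assignment over $\mathfrak{A}$ is a (possibly empty) function $f:X\to A$ with $X\subseteq\mathrm{VAR}$ finite; $f\frac{a}{x}$ is the assignment with domain $\mathrm{dom}(f)\cup\{x\}$ that maps $x$ to $a$ and agrees with $f$ elsewhere, and $\frac{a}{x}$ alone denotes the assignment $\{(x,a)\}$. A generalized quantifier of width $1$ and type $(1)$ is an isomorphism-closed class $Q$ of structures $(D,P)$ with $P\subseteq D$. For a finite set $\mathcal{Q}$ of these (which need not contain $\exists$ or $\forall$), $\mathrm{FO}(\mathcal{Q})$ is built from the atomic formulas $x=y$ and $R(x_1,\dots,x_k)$ using Boolean connectives and $Qx\,\varphi$ for $Q\in\mathcal{Q}$, $x\in\mathrm{VAR}$. Semantics: atoms and connectives as usual, and $\mathfrak{A},f\models Qx\,\varphi$ iff $(A,\|\varphi\|^{\mathfrak{A},f}_x)\in Q$, where $\|\varphi\|^{\mathfrak{A},f}_x=\{a\in A\mid \mathfrak{A},f\frac{a}{x}\models\varphi\}$; here $\mathrm{dom}(f)$ contains all free variables of the formula being evaluated. The quantifier depth of a formula is its maximum number of nested quantifiers from $\mathcal{Q}$ (Boolean connectives do not count); $\mathrm{FO}(\mathcal{Q})^d$ is the set of formulas of depth at most $d$. $(\mathfrak{A},f)$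 and $(\mathfrak{B},g)$ are separable in $\mathrm{FO}(\mathcal{Q})^d$ if some $\varphi\in\mathrm{FO}(\mathcal{Q})^d$ satisfies $\mathfrak{A},f\models\varphi$ and $\mathfrak{B},g\not\models\varphi$. **Partial isomorphism.** A pair $(f,g)$ of assignments with $\mathrm{dom}(f)=\mathrm{dom}(g)$ induces a partial isomorphism between $\mathfrak{A}$ and $\mathfrak{B}$ if $\mathfrak{A},f\models\alpha\iff\mathfrak{B},g\models\alpha$ for every atomic $\alpha$ with free variables in $\mathrm{dom}(f)$. **The game.** $\mathrm{EF}\{\mathcal{Q}\}(\mathfrak{A},\mathfrak{B},f,g)$ is a two-player game starting from position $(\mathfrak{A},\mathfrak{B},f,g)$ with Player $\mathbb{I}$ as attacker and Player $\mathbb{II}$ as defender. A round from position $(\mathfrak{M},\mathfrak{N},h,h')$ goes as follows. 1. The attacker chooses $Q\in\mathcal{Q}$ and $x\in\mathrm{VAR}$. 2. The attacker chooses a witness set $X$ from the domain of either model (without loss of generality $X\subseteq M$; equivalently, the attacker may first switch which model is called $\mathfrak{M}$ and which $\mathfrak{N}$) with $(M,X)\in Q$, and a spillover set $P\subseteq N$ from the domain of the other model. 3. The defender chooses a witness set $X'\subseteq N$ with $(N,X')\in Q$ and $P\subseteq X'$. 4. The attacker does one of the following. (a) Chooses $v'\in N\setminus X'$ and $v\in X$; the players swap roles; the next position is $(\mathfrak{M},\mathfrak{N},h\frac{v}{x},h'\frac{v'}{x})$. (b) Chooses $v'\in X'$; the defender then either chooses $v\in X$, after which the next position is $(\mathfrak{M},\mathfrak{N},h\frac{v}{x},h'\frac{v'}{x})$,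 or chooses $v\in P$, after which the next position is $(\mathfrak{N},\mathfrak{N},\frac{v}{x},\frac{v'}{x})$. 5. If the pair of assignments of the position just determined does not induce a partial isomorphism between its two models, the game ends and the attacker wins; otherwise a new round begins from this position. Contesting: at any point during steps 2–3, immediately after a set is chosen, the opposing player may contest that choice; the remaining steps of the round are then skipped and replaced as follows. *Contesting a witness set:* after $X$ is chosen in step 2 or $X'$ in step 3, the opposing player chooses $u\in Y$ and $u'\in W\setminus Y$, where $Y$ is the contested set and $W$ its domain; if the contesting player is the attacker, the players swap roles; the next position is $(\mathfrak{W},\mathfrak{W},h_W\frac{u}{x},h_W\frac{u'}{x})$, where $h_W=h$ if $W=M$ and $h_W=h'$ if $W=N$. *Contesting a spillover set:* after $P$ is chosen in step 2, the opposing player chooses $v'\in P$ and $v\in M$; the next position is $(\mathfrak{M},\mathfrak{N},h\frac{v}{x},h'\frac{v'}{x})$. In both cases the game proceeds to step 5 with the new position. If at any point a player must make a move but cannot do so, the other player wins immediately. **Bounded game.** The winner of the $\mathrm{EF}_d\{\mathcal{Q}\}(\mathfrak{A},\mathfrak{B},f,g)$-game, in which the number of rounds played is restricted to $d$, is defined as follows. $\mathrm{EF}_0\{\mathcal{Q}\}(\mathfrak{A},\mathfrak{B},f,g)$ is won by Player $\mathbb{I}$ if $(f,g)$ does not induce a partial isomorphism between $\mathfrak{A}$ and $\mathfrak{B}$, and otherwise by Player $\mathbb{II}$. $\mathrm{EF}_{d+1}\{\mathcal{Q}\}(\mathfrak{A},\mathfrak{B},f,g)$ is won by Player $\mathbb{II}$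 if Player $\mathbb{I}$ has not won the game after $d+1$ rounds have been played.
   Formalization: In step 4(b), choosing v in P leads to (N,N,h'v/x,h'v'/x), not to one-point assignments (with those the lemma fails); after a role swap, running out of rounds is a win for the current defender; an initial position that is no partial isomorphism is already a win for Player I. *)

theory Defs
  imports Main
begin

section \<open>Models, assignments and generalized quantifiers\<close>

type_synonym var = nat

text \<open>
  A vocabulary maps each of its relation symbols to its arity. Models have their domain inside a
  type \<^typ>\<open>'a\<close>, which is arbitrary, so that two models may have unrelated domains and one quantifier
  can be evaluated in all of them.
\<close>

type_synonym 'r vocabulary = "'r \<Rightarrow> nat option"

record ('r, 'a) model =
  Dom :: "'a set"
  Rel :: "'r \<Rightarrow> 'a list set"

definition is_model :: "'r vocabulary \<Rightarrow> ('r, 'a) model \<Rightarrow> bool" where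
  "is_model \<tau> M \<longleftrightarrow>
     Dom M \<noteq> {} \<and>
     (\<forall>R k. \<tau> R = Some k \<longrightarrow> Rel M R \<subseteq> {xs. length xs = k \<and> set xs \<subseteq> Dom M})"

type_synonym 'a assignment = "var \<Rightarrow> 'a option"

definition assignment_over :: "('r, 'a) model \<Rightarrow> 'a assignment \<Rightarrow> bool" where
  "assignment_over M f \<longleftrightarrow> finite (dom f) \<and> ran f \<subseteq> Dom M"

type_synonym 'a quant = "('a set \<times> 'a set) set"

definition generalized_quantifier :: "'a quant \<Rightarrow> bool" where
  "generalized_quantifier Q \<longleftrightarrow>
     (\<forall>(D, P) \<in> Q. P \<subseteq> D) \<and>
     (\<forall>D P D' h. (D, P) \<in> Q \<longrightarrow> bij_betw h D D' \<longrightarrow> (D', h ` P) \<in> Q)"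


section \<open>The logic\<close>

datatype ('r, 'a) formula =
    Equal var var
  | Atom 'r "var list"
  | Neg "('r, 'a) formula"
  | Conj "('r, 'a) formula" "('r, 'a) formula"
  | Quant "'a quant" var "('r, 'a) formula"

fun free_vars :: "('r, 'a) formula \<Rightarrow> var set" where
  "free_vars (Equal x y) = {x, y}"
| "free_vars (Atom R xs) = set xs"
| "free_vars (Neg \<phi>) = free_vars \<phi>"
| "free_vars (Conj \<phi> \<psi>) = free_vars \<phi> \<union> free_vars \<psi>"
| "free_vars (Quant Q x \<phi>) = free_vars \<phi> - {x}"

fun quantifier_depth :: "('r, 'a) formula \<Rightarrow> nat" where
  "quantifier_depth (Equal x y) = 0"
| "quantifier_depth (Atom R xs) = 0"
| "quantifier_depth (Neg \<phi>) = quantifier_depth \<phi>"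
| "quantifier_depth (Conj \<phi> \<psi>) = max (quantifier_depth \<phi>) (quantifier_depth \<psi>)"
| "quantifier_depth (Quant Q x \<phi>) = Suc (quantifier_depth \<phi>)"

inductive_set FO :: "'r vocabulary \<Rightarrow> 'a quant set \<Rightarrow> ('r, 'a) formula set"
  for \<tau> :: "'r vocabulary" and \<Q> :: "'a quant set" where
  "Equal x y \<in> FO \<tau> \<Q>"
| "\<tau> R = Some (length xs) \<Longrightarrow> Atom R xs \<in> FO \<tau> \<Q>"
| "\<phi> \<in> FO \<tau> \<Q> \<Longrightarrow> Neg \<phi> \<in> FO \<tau> \<Q>"
| "\<phi> \<in> FO \<tau> \<Q> \<Longrightarrow> \<psi> \<in> FO \<tau> \<Q> \<Longrightarrow> Conj \<phi> \<psi> \<in> FO \<tau> \<Q>"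
| "Q \<in> \<Q> \<Longrightarrow> \<phi> \<in> FO \<tau> \<Q> \<Longrightarrow> Quant Q x \<phi> \<in> FO \<tau> \<Q>"

definition FO_depth :: "'r vocabulary \<Rightarrow> 'a quant set \<Rightarrow> nat \<Rightarrow> ('r, 'a) formula set" where
  "FO_depth \<tau> \<Q> d = {\<phi> \<in> FO \<tau> \<Q>. quantifier_depth \<phi> \<le> d}"

text \<open>Only meaningful if the free variables of the formula are in \<^term>\<open>dom f\<close>.\<close>

fun sat :: "('r, 'a) model \<Rightarrow> 'a assignment \<Rightarrow> ('r, 'a) formula \<Rightarrow> bool" where
  "sat M f (Equal x y) \<longleftrightarrow> the (f x) = the (f y)"
| "sat M f (Atom R xs) \<longleftrightarrow> map (\<lambda>x. the (f x)) xs \<in> Rel M R"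
| "sat M f (Neg \<phi>) \<longleftrightarrow> \<not> sat M f \<phi>"
| "sat M f (Conj \<phi> \<psi>) \<longleftrightarrow> sat M f \<phi> \<and> sat M f \<psi>"
| "sat M f (Quant Q x \<phi>) \<longleftrightarrow> (Dom M, {a \<in> Dom M. sat M (f(x \<mapsto> a)) \<phi>}) \<in> Q"

definition separable ::
  "'r vocabulary \<Rightarrow> 'a quant set \<Rightarrow> nat \<Rightarrow>
   ('r, 'a) model \<Rightarrow> ('r, 'a) model \<Rightarrow> 'a assignment \<Rightarrow> 'a assignment \<Rightarrow> bool" where
  "separable \<tau> \<Q> d A B f g \<longleftrightarrow>
     (\<exists>\<phi> \<in> FO_depth \<tau> \<Q> d.
        free_vars \<phi> \<subseteq> dom f \<and> free_vars \<phi> \<subseteq> dom g \<and> sat A f \<phi> \<and> \<not> sat B g \<phi>)"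

definition atomic :: "'r vocabulary \<Rightarrow> ('r, 'a) formula \<Rightarrow> bool" where
  "atomic \<tau> \<alpha> \<longleftrightarrow>
     (\<exists>x y. \<alpha> = Equal x y) \<or> (\<exists>R xs. \<alpha> = Atom R xs \<and> \<tau> R = Some (length xs))"

definition partial_isomorphism ::
  "'r vocabulary \<Rightarrow> ('r, 'a) model \<Rightarrow> ('r, 'a) model \<Rightarrow> 'a assignment \<Rightarrow> 'a assignment \<Rightarrow> bool" where
  "partial_isomorphism \<tau> A B f g \<longleftrightarrow>
     dom f = dom g \<and>
     (\<forall>\<alpha>. atomic \<tau> \<alpha> \<and> free_vars \<alpha> \<subseteq> dom f \<longrightarrow> (sat A f \<alpha> \<longleftrightarrow> sat B g \<alpha>))"


section \<open>The game\<close>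

datatype player = Player_I | Player_II

fun opponent :: "player \<Rightarrow> player" where
  "opponent Player_I = Player_II"
| "opponent Player_II = Player_I"

type_synonym ('r, 'a) position =
  "('r, 'a) model \<times> ('r, 'a) model \<times> 'a assignment \<times> 'a assignment"

fun switch :: "('r, 'a) position \<Rightarrow> ('r, 'a) position" where
  "switch (M, N, h, h') = (N, M, h', h)"

text \<open>
  Every state carries the player who is currently the attacker. The number in \<open>Round_Start\<close> counts
  the rounds that may still be played, the one in the other states those left after the round in
  progress. In \<open>Witness_Chosen\<close> the set \<open>X\<close> may still be contested; in \<open>Witness_Accepted\<close> it may
  not, and the attacker has to choose the spillover set.
\<close>

datatype ('r, 'a) state =
    Round_Start nat player "('r, 'a) position"
  | Quantifier_Chosen nat player "('r, 'a) position" "'a quant" var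
  | Witness_Chosen nat player "('r, 'a) position" "'a quant" var "'a set"
  | Witness_Accepted nat player "('r, 'a) position" "'a quant" var "'a set"
  | Spillover_Chosen nat player "('r, 'a) position" "'a quant" var "'a set" "'a set"
  | Answer_Chosen nat player "('r, 'a) position" "'a quant" var "'a set" "'a set" "'a set"
  | Element_Chosen nat player "('r, 'a) position" "'a quant" var "'a set" "'a set" 'a

fun to_move :: "('r, 'a) state \<Rightarrow> player" where
  "to_move (Round_Start n p pos) = p"
| "to_move (Quantifier_Chosen n p pos Q x) = p"
| "to_move (Witness_Chosen n p pos Q x X) = opponent p"
| "to_move (Witness_Accepted n p pos Q x X) = p"
| "to_move (Spillover_Chosen n p pos Q x X P) = opponent p"
| "to_move (Answer_Chosen n p pos Q x X P X') = p"
| "to_move (Element_Chosen n p pos Q x X P v') = opponent p"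

text \<open>
  The position at the start of a round is the one determined in the preceding round, or the initial
  one. If it is not a partial isomorphism, the player who is now the attacker has won; if it is and
  no rounds are left, the player who is now the defender has won. Thus, after the roles have been
  swapped, the rest of the game is the bounded game with the names of the players exchanged.
\<close>

fun winner :: "'r vocabulary \<Rightarrow> ('r, 'a) state \<Rightarrow> player option" where
  "winner \<tau> (Round_Start n p (M, N, h, h')) =
     (if \<not> partial_isomorphism \<tau> M N h h' then Some p
      else if n = 0 then Some (opponent p)
      else None)"
| "winner \<tau> _ = None"

text \<open>
  In \<open>choose_spillover_element\<close> both assignments extend \<open>h'\<close>, the assignment over \<open>N\<close>, as they
  do in all other moves that lead to a position with two equal models. Read literally, the notation
  \<open>v/x\<close>, \<open>v'/x\<close> for this position denotes the one-point assignments \<open>[x \<mapsto> v]\<close>, \<open>[x \<mapsto> v']\<close>. With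
  those, separable pairs would exist on which the attacker loses, already for one round and the
  empty vocabulary: take \<open>|A| = 1\<close>, \<open>|B| = 3\<close>, \<open>dom f = dom g = {y}\<close> and the single
  quantifier \<open>{(D, P). P \<subseteq> D \<and> (|D| = 1 \<or> |D| = 3 \<and> |P| \<noteq> 2)}\<close>, with the formula
  \<open>Q x. x \<noteq> y\<close>.
\<close>

inductive move :: "'a quant set \<Rightarrow> ('r, 'a) state \<Rightarrow> ('r, 'a) state \<Rightarrow> bool"
  for \<Q> :: "'a quant set" where
  choose_quantifier:
    "Q \<in> \<Q> \<Longrightarrow>
     move \<Q> (Round_Start (Suc n) p pos) (Quantifier_Chosen n p pos Q x)"
| choose_witness:
    "pos' \<in> {pos, switch pos} \<Longrightarrow> pos' = (M, N, h, h') \<Longrightarrow> X \<subseteq> Dom M \<Longrightarrow> (Dom M, X) \<in> Q \<Longrightarrow>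
     move \<Q> (Quantifier_Chosen n p pos Q x) (Witness_Chosen n p pos' Q x X)"
| contest_witness:
    "u \<in> X \<Longrightarrow> u' \<in> Dom M - X \<Longrightarrow>
     move \<Q> (Witness_Chosen n p (M, N, h, h') Q x X)
       (Round_Start n p (M, M, h(x \<mapsto> u), h(x \<mapsto> u')))"
| accept_witness:
    "move \<Q> (Witness_Chosen n p pos Q x X) (Witness_Accepted n p pos Q x X)"
| choose_spillover:
    "P \<subseteq> Dom N \<Longrightarrow>
     move \<Q> (Witness_Accepted n p (M, N, h, h') Q x X)
       (Spillover_Chosen n p (M, N, h, h') Q x X P)"
| contest_spillover:
    "v' \<in> P \<Longrightarrow> v \<in> Dom M \<Longrightarrow>
     move \<Q> (Spillover_Chosen n p (M, N, h, h') Q x X P)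
       (Round_Start n p (M, N, h(x \<mapsto> v), h'(x \<mapsto> v')))"
| choose_answer:
    "X' \<subseteq> Dom N \<Longrightarrow> (Dom N, X') \<in> Q \<Longrightarrow> P \<subseteq> X' \<Longrightarrow>
     move \<Q> (Spillover_Chosen n p (M, N, h, h') Q x X P)
       (Answer_Chosen n p (M, N, h, h') Q x X P X')"
| contest_answer:
    "u \<in> X' \<Longrightarrow> u' \<in> Dom N - X' \<Longrightarrow>
     move \<Q> (Answer_Chosen n p (M, N, h, h') Q x X P X')
       (Round_Start n (opponent p) (N, N, h'(x \<mapsto> u), h'(x \<mapsto> u')))"
| choose_swap:
    "v' \<in> Dom N - X' \<Longrightarrow> v \<in> X \<Longrightarrow>
     move \<Q> (Answer_Chosen n p (M, N, h, h') Q x X P X')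
       (Round_Start n (opponent p) (M, N, h(x \<mapsto> v), h'(x \<mapsto> v')))"
| choose_element:
    "v' \<in> X' \<Longrightarrow>
     move \<Q> (Answer_Chosen n p pos Q x X P X') (Element_Chosen n p pos Q x X P v')"
| choose_witness_element:
    "v \<in> X \<Longrightarrow>
     move \<Q> (Element_Chosen n p (M, N, h, h') Q x X P v')
       (Round_Start n p (M, N, h(x \<mapsto> v), h'(x \<mapsto> v')))"
| choose_spillover_element:
    "v \<in> P \<Longrightarrow>
     move \<Q> (Element_Chosen n p (M, N, h, h') Q x X P v')
       (Round_Start n p (N, N, h'(x \<mapsto> v), h'(x \<mapsto> v')))"

text \<open>
  \<open>winning \<tau> \<Q> p \<sigma> s\<close>: player \<open>p\<close> wins every play from \<open>s\<close> in which he follows the strategy \<open>\<sigma>\<close>.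
  A player who has to move but has no move loses: for \<open>p\<close> himself \<open>own_move\<close> is then inapplicable,
  for his opponent the premise of \<open>opponent_move\<close> holds vacuously.
\<close>

inductive winning ::
  "'r vocabulary \<Rightarrow> 'a quant set \<Rightarrow> player \<Rightarrow>
   (('r, 'a) state \<Rightarrow> ('r, 'a) state) \<Rightarrow> ('r, 'a) state \<Rightarrow> bool"
  for \<tau> :: "'r vocabulary" and \<Q> :: "'a quant set" and p :: player
    and \<sigma> :: "('r, 'a) state \<Rightarrow> ('r, 'a) state" where
  game_over:
    "winner \<tau> s = Some p \<Longrightarrow> winning \<tau> \<Q> p \<sigma> s"
| own_move:
    "winner \<tau> s = None \<Longrightarrow> to_move s = p \<Longrightarrow> move \<Q> s (\<sigma> s) \<Longrightarrow> winning \<tau> \<Q> p \<sigma> (\<sigma> s) \<Longrightarrow>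
     winning \<tau> \<Q> p \<sigma> s"
| opponent_move:
    "winner \<tau> s = None \<Longrightarrow> to_move s = opponent p \<Longrightarrow>
     (\<And>t. move \<Q> s t \<Longrightarrow> winning \<tau> \<Q> p \<sigma> t) \<Longrightarrow>
     winning \<tau> \<Q> p \<sigma> s"

definition player_I_has_winning_strategy ::
  "'r vocabulary \<Rightarrow> 'a quant set \<Rightarrow> nat \<Rightarrow>
   ('r, 'a) model \<Rightarrow> ('r, 'a) model \<Rightarrow> 'a assignment \<Rightarrow> 'a assignment \<Rightarrow> bool" where
  "player_I_has_winning_strategy \<tau> \<Q> d A B f g \<longleftrightarrow>
     (\<exists>\<sigma>. winning \<tau> \<Q> Player_I \<sigma> (Round_Start d Player_I (A, B, f, g)))"

end

theory Submission
  imports Defs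
begin

text \<open>
  Negation and conjunction cannot create a difference, so \<open>(A, f)\<close> and \<open>(B, g)\<close> are already told
  apart by an atomic formula, in which case the attacker has won at once, or by some \<open>Q x. \<phi>\<close> with
  \<open>\<phi>\<close> of depth at most \<open>d\<close>. Name the models \<open>M\<close>, \<open>N\<close> such that \<open>Q x. \<phi>\<close> holds in \<open>M\<close> and fails in
  \<open>N\<close>. Player I plays the witness set \<open>X\<close> that \<open>\<phi>\<close> defines in \<open>M\<close>. Let \<open>Y\<close> be the set that \<open>\<phi>\<close>
  defines in \<open>N\<close>. As spillover set he plays those elements of \<open>Y\<close> that formulas of depth at most \<open>d\<close>
  separate from every element of \<open>M\<close>. Contesting either set leads to a separable pair, hence to a
  position that he wins as attacker. The answer \<open>X'\<close> belongs to \<open>Q\<close> and \<open>Y\<close> does not, so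
  \<open>X' \<noteq> Y\<close>, and there are two ways to profit.

  If \<open>X'\<close> contains some \<open>v' \<notin> Y\<close>, he chooses it: whatever element \<open>v\<close> of \<open>X\<close> or of the spillover
  set the defender picks satisfies \<open>\<phi>\<close>, so \<open>\<phi>\<close> separates the resulting pair. If \<open>X'\<close> misses some
  \<open>v' \<in> Y\<close>, then \<open>v'\<close> is outside the spillover set, so some \<open>v\<close> in \<open>M\<close> is inseparable from \<open>v'\<close>;
  as \<open>\<phi>\<close> has depth at most \<open>d\<close>, this \<open>v\<close> lies in \<open>X\<close>. He plays this pair, the roles are swapped,
  and he has to defend an inseparable position.

  The induction hypothesis speaks only about Player I as attacker. That he can defend inseparable
  positions follows from it because the game is determined (\<open>winning_region_determined\<close>) and
  symmetric under exchanging the names of the players (\<open>winning_region_flip\<close>). The strategies for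
  the various continuations are merged by passing to the winning region, on which one positional
  strategy wins everywhere (\<open>winning_strategy_iff_winning_region\<close>).
\<close>

section \<open>Winning regions and determinacy\<close>

text \<open>
  In contrast to \<^const>\<open>winning\<close>, no strategy is fixed here, so facts about different successor
  states combine without any bookkeeping.
\<close>

inductive winning_region ::
  "'r vocabulary \<Rightarrow> 'a quant set \<Rightarrow> player \<Rightarrow> ('r, 'a) state \<Rightarrow> bool"
  for \<tau> :: "'r vocabulary" and \<Q> :: "'a quant set" and p :: player where
  game_over:
    "winner \<tau> s = Some p \<Longrightarrow> winning_region \<tau> \<Q> p s"
| own_move:
    "winner \<tau> s = None \<Longrightarrow> to_move s = p \<Longrightarrow> move \<Q> s t \<Longrightarrow> winning_region \<tau> \<Q> p t \<Longrightarrow>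
     winning_region \<tau> \<Q> p s"
| opponent_move:
    "winner \<tau> s = None \<Longrightarrow> to_move s = opponent p \<Longrightarrow>
     (\<And>t. move \<Q> s t \<Longrightarrow> winning_region \<tau> \<Q> p t) \<Longrightarrow>
     winning_region \<tau> \<Q> p s"

text \<open>
  The factor 7 leaves room for the six intermediate states of a round between two starting states.
\<close>

fun moves_left :: "('r, 'a) state \<Rightarrow> nat" where
  "moves_left (Round_Start n p pos) = 7 * n"
| "moves_left (Quantifier_Chosen n p pos Q x) = 7 * n + 6"
| "moves_left (Witness_Chosen n p pos Q x X) = 7 * n + 5"
| "moves_left (Witness_Accepted n p pos Q x X) = 7 * n + 4"
| "moves_left (Spillover_Chosen n p pos Q x X P) = 7 * n + 3"
| "moves_left (Answer_Chosen n p pos Q x X P X') = 7 * n + 2"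
| "moves_left (Element_Chosen n p pos Q x X P v') = 7 * n + 1"

lemma moves_left_decreases: "move \<Q> s t \<Longrightarrow> moves_left t < moves_left s"
  by (induction rule: move.induct) auto

lemma opponent_opponent [simp]: "opponent (opponent p) = p"
  by (cases p) auto

lemma player_cases: "q = p \<or> q = opponent p"
  by (cases p; cases q) auto

lemma winning_region_if_winning:
  "winning \<tau> \<Q> p \<sigma> s \<Longrightarrow> winning_region \<tau> \<Q> p s"
proof (induction rule: winning.induct)
  case (game_over s)
  then show ?case by (rule winning_region.game_over)
next
  case (own_move s)
  from own_move(1-3,5) show ?case by (rule winning_region.own_move)
next
  case (opponent_move s)
  from opponent_move(1,2,4) show ?case by (rule winning_region.opponent_move)
qed

text \<open>
  The strategy that always moves to some state of the winning region wins: the region can always be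
  kept, and since every play is finite, it ends in a state of the region, that is, in a win.
\<close>

lemma winning_strategy_iff_winning_region:
  "(\<exists>\<sigma>. winning \<tau> \<Q> p \<sigma> s) \<longleftrightarrow> winning_region \<tau> \<Q> p s"
proof
  assume "\<exists>\<sigma>. winning \<tau> \<Q> p \<sigma> s"
  then show "winning_region \<tau> \<Q> p s"
    using winning_region_if_winning by blast
next
  define \<sigma> where "\<sigma> = (\<lambda>s. SOME t. move \<Q> s t \<and> winning_region \<tau> \<Q> p t)"
  assume "winning_region \<tau> \<Q> p s"
  then have "winning \<tau> \<Q> p \<sigma> s"
  proof (induction s rule: measure_induct_rule[where f = moves_left])
    case (less s)
    from less.prems show ?case
    proof cases
      case game_over
      then show ?thesis by (rule winning.game_over)
    next
      case (own_move t)
      then have "move \<Q> s (\<sigma> s) \<and> winning_region \<tau> \<Q> p (\<sigma> s)"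
        unfolding \<sigma>_def
        using someI[of "\<lambda>t. move \<Q> s t \<and> winning_region \<tau> \<Q> p t" t] by blast
      moreover from this have "winning \<tau> \<Q> p \<sigma> (\<sigma> s)"
        using less.IH[OF moves_left_decreases[of \<Q> s "\<sigma> s"]] by simp
      ultimately show ?thesis
        using own_move(1,2) by (intro winning.own_move[of \<tau> s p \<Q> \<sigma>]) auto
    next
      case opponent_move
      have "winning \<tau> \<Q> p \<sigma> t" if "move \<Q> s t" for t
        using less.IH[OF moves_left_decreases[OF that]] opponent_move(3)[OF that] .
      with opponent_move(1,2) show ?thesis by (rule winning.opponent_move)
    qed
  qed
  then show "\<exists>\<sigma>. winning \<tau> \<Q> p \<sigma> s" by blast
qed

text \<open>Zermelo's backward induction for games in which every play is finite.\<close>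

lemma winning_region_determined:
  "winning_region \<tau> \<Q> p s \<or> winning_region \<tau> \<Q> (opponent p) s"
proof (induction s rule: measure_induct_rule[where f = moves_left])
  case (less s)
  have successors: "winning_region \<tau> \<Q> p t \<or> winning_region \<tau> \<Q> (opponent p) t"
    if "move \<Q> s t" for t
    using less.IH[OF moves_left_decreases[OF that]] .
  show ?case
  proof (cases "winner \<tau> s")
    case None
    have moving: "winning_region \<tau> \<Q> q s \<or> winning_region \<tau> \<Q> (opponent q) s"
      if "to_move s = q"
        and "\<And>t. move \<Q> s t \<Longrightarrow> winning_region \<tau> \<Q> q t \<or> winning_region \<tau> \<Q> (opponent q) t"
      for q
    proof (cases "\<exists>t. move \<Q> s t \<and> winning_region \<tau> \<Q> q t")
      case True
      then obtain t where "move \<Q> s t" "winning_region \<tau> \<Q> q t" by blast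
      with None that(1) have "winning_region \<tau> \<Q> q s"
        by (rule winning_region.own_move)
      then show ?thesis ..
    next
      case False
      with that(2) have "\<And>t. move \<Q> s t \<Longrightarrow> winning_region \<tau> \<Q> (opponent q) t"
        by blast
      moreover have "to_move s = opponent (opponent q)" using that(1) by simp
      ultimately have "winning_region \<tau> \<Q> (opponent q) s"
        using None by (intro winning_region.opponent_move[of \<tau> s "opponent q"])
      then show ?thesis ..
    qed
    from player_cases[of "to_move s" p] show ?thesis
    proof
      assume "to_move s = p"
      then show ?thesis using successors by (rule moving)
    next
      assume "to_move s = opponent p"
      then have "winning_region \<tau> \<Q> (opponent p) s \<or>
          winning_region \<tau> \<Q> (opponent (opponent p)) s"
        by (rule moving) (use successors in auto)
      then show ?thesis by auto
    qed
  next
    case (Some q)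
    then have "winning_region \<tau> \<Q> q s" by (rule winning_region.game_over)
    with player_cases[of q p] show ?thesis by auto
  qed
qed

section \<open>Exchanging the names of the players\<close>

fun flip :: "('r, 'a) state \<Rightarrow> ('r, 'a) state" where
  "flip (Round_Start n p pos) = Round_Start n (opponent p) pos"
| "flip (Quantifier_Chosen n p pos Q x) = Quantifier_Chosen n (opponent p) pos Q x"
| "flip (Witness_Chosen n p pos Q x X) = Witness_Chosen n (opponent p) pos Q x X"
| "flip (Witness_Accepted n p pos Q x X) = Witness_Accepted n (opponent p) pos Q x X"
| "flip (Spillover_Chosen n p pos Q x X P) = Spillover_Chosen n (opponent p) pos Q x X P"
| "flip (Answer_Chosen n p pos Q x X P X') = Answer_Chosen n (opponent p) pos Q x X P X'"
| "flip (Element_Chosen n p pos Q x X P v') = Element_Chosen n (opponent p) pos Q x X P v'"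

lemma flip_flip [simp]: "flip (flip s) = s"
  by (cases s) auto

lemma to_move_flip [simp]: "to_move (flip s) = opponent (to_move s)"
  by (cases s) auto

lemma winner_flip [simp]: "winner \<tau> (flip s) = map_option opponent (winner \<tau> s)"
  by (cases "(\<tau>, s)" rule: winner.cases) auto

lemma move_flip: "move \<Q> s t \<Longrightarrow> move \<Q> (flip s) (flip t)"
proof (induction rule: move.induct)
  case (contest_answer u X' u' N n p M h h' Q x X P)
  then show ?case using move.contest_answer[of u X' u' N \<Q> n "opponent p"] by simp
next
  case (choose_swap v' N X' v X n p M h h' Q x P)
  then show ?case using move.choose_swap[of v' N X' v X \<Q> n "opponent p"] by simp
qed (auto intro: move.intros)

lemma winning_region_flip:
  "winning_region \<tau> \<Q> p s \<Longrightarrow> winning_region \<tau> \<Q> (opponent p) (flip s)"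
proof (induction rule: winning_region.induct)
  case (game_over s)
  then show ?case by (intro winning_region.game_over) simp
next
  case (own_move s t)
  then show ?case
    by (intro winning_region.own_move[of _ "flip s" _ _ "flip t"]) (auto intro: move_flip)
next
  case (opponent_move s)
  show ?case
  proof (rule winning_region.opponent_move)
    fix t
    assume "move \<Q> (flip s) t"
    then have "move \<Q> s (flip t)" using move_flip by fastforce
    then show "winning_region \<tau> \<Q> (opponent p) t" using opponent_move.IH by fastforce
  qed (use opponent_move.hyps in auto)
qed

text \<open>
  By symmetry, the opponent of \<open>p\<close> cannot win from \<open>pos\<close> as attacker either, and determinacy turns
  this into a win for \<open>p\<close>. For Player I it is needed after the roles have been swapped.
\<close>

lemma defender_wins_if_attacker_loses:
  assumes "\<not> winning_region \<tau> \<Q> p (Round_Start n p pos)"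
  shows "winning_region \<tau> \<Q> p (Round_Start n (opponent p) pos)"
proof -
  have "\<not> winning_region \<tau> \<Q> (opponent p) (Round_Start n (opponent p) pos)"
    using assms winning_region_flip[of \<tau> \<Q> "opponent p" "Round_Start n (opponent p) pos"] by auto
  then show ?thesis
    using winning_region_determined by blast
qed

section \<open>Separability\<close>

text \<open>Closure under negation makes the direction of the difference irrelevant.\<close>

lemma separableI:
  assumes "\<phi> \<in> FO_depth \<tau> \<Q> d" "free_vars \<phi> \<subseteq> dom f" "dom f = dom g"
    and "sat A f \<phi> \<noteq> sat B g \<phi>"
  shows "separable \<tau> \<Q> d A B f g"
proof (cases "sat A f \<phi>")
  case True
  then show ?thesis using assms unfolding separable_def by blast
next
  case False
  have "Neg \<phi> \<in> FO_depth \<tau> \<Q> d"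
    using assms(1) by (auto simp: FO_depth_def intro: FO.intros)
  moreover have "free_vars (Neg \<phi>) \<subseteq> dom f" "sat A f (Neg \<phi>)" "\<not> sat B g (Neg \<phi>)"
    using False assms by auto
  ultimately show ?thesis using assms(3) unfolding separable_def by metis
qed

text \<open>
  Descend through negations and conjunctions along a subformula on which the two sides differ. It
  cannot be atomic, because the assignments induce a partial isomorphism.
\<close>

lemma distinguishing_quantifier:
  assumes "\<phi> \<in> FO \<tau> \<Q>" "quantifier_depth \<phi> \<le> Suc d" "free_vars \<phi> \<subseteq> dom f"
    and "partial_isomorphism \<tau> A B f g" "sat A f \<phi> \<noteq> sat B g \<phi>"
  obtains Q x \<psi> where "Q \<in> \<Q>" "\<psi> \<in> FO_depth \<tau> \<Q> d" "free_vars \<psi> \<subseteq> insert x (dom f)"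
    "sat A f (Quant Q x \<psi>) \<noteq> sat B g (Quant Q x \<psi>)"
proof -
  have atoms: "sat A f \<alpha> = sat B g \<alpha>" if "atomic \<tau> \<alpha>" "free_vars \<alpha> \<subseteq> dom f" for \<alpha>
    using assms(4) that unfolding partial_isomorphism_def by blast
  from assms(1-3,5) have "\<exists>Q x \<psi>. Q \<in> \<Q> \<and> \<psi> \<in> FO_depth \<tau> \<Q> d \<and>
    free_vars \<psi> \<subseteq> insert x (dom f) \<and> sat A f (Quant Q x \<psi>) \<noteq> sat B g (Quant Q x \<psi>)"
  proof (induction rule: FO.induct)
    case (1 x y)
    then show ?case using atoms[of "Equal x y"] unfolding atomic_def by blast
  next
    case (2 R xs)
    then show ?case using atoms[of "Atom R xs"] unfolding atomic_def by blast
  next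
    case (3 \<phi>)
    then show ?case by simp
  next
    case (4 \<phi> \<psi>)
    from "4.prems" have "sat A f \<phi> \<noteq> sat B g \<phi> \<or> sat A f \<psi> \<noteq> sat B g \<psi>" by auto
    with 4 show ?case by fastforce
  next
    case (5 Q \<phi> x)
    then have "\<phi> \<in> FO_depth \<tau> \<Q> d" "free_vars \<phi> \<subseteq> insert x (dom f)"
      by (auto simp: FO_depth_def)
    with 5 show ?case by blast
  qed
  with that show thesis by blast
qed

lemma assignment_over_upd:
  "assignment_over M f \<Longrightarrow> a \<in> Dom M \<Longrightarrow> assignment_over M (f(x \<mapsto> a))"
  unfolding assignment_over_def by (auto simp: ran_def)

section \<open>The attacking round\<close>

text \<open>
  The quantifier has been chosen, \<open>Q x. \<phi>\<close> being true in \<open>M\<close> and false in \<open>N\<close>. The assumption on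
  \<open>pos\<close> lets \<open>M\<close> be either of its two models, as the attacker may switch them. The last two
  assumptions summarize the \<open>n\<close> rounds that follow: Player I wins separable positions as attacker
  and inseparable ones as defender.
\<close>

lemma quantifier_round:
  fixes M N :: "('r, 'a) model"
  assumes witness: "(Dom M, {a \<in> Dom M. sat M (h(x \<mapsto> a)) \<phi>}) \<in> Q"
    and no_witness: "(Dom N, {a \<in> Dom N. sat N (h'(x \<mapsto> a)) \<phi>}) \<notin> Q"
    and formula: "\<phi> \<in> FO_depth \<tau> \<Q> n" "free_vars \<phi> \<subseteq> insert x (dom h)"
    and models: "is_model \<tau> M" "is_model \<tau> N"
    and assignments: "assignment_over M h" "assignment_over N h'" "dom h = dom h'"
    and pos: "(M, N, h, h') \<in> {pos, switch pos}"
    and attack: "\<And>(A :: ('r, 'a) model) (B :: ('r, 'a) model) f g. is_model \<tau> A \<Longrightarrow> is_model \<tau> B \<Longrightarrow>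
      assignment_over A f \<Longrightarrow> assignment_over B g \<Longrightarrow> dom f = dom g \<Longrightarrow>
      separable \<tau> \<Q> n A B f g \<Longrightarrow>
      winning_region \<tau> \<Q> Player_I (Round_Start n Player_I (A, B, f, g))"
    and defence: "\<And>(A :: ('r, 'a) model) (B :: ('r, 'a) model) f g. is_model \<tau> A \<Longrightarrow> is_model \<tau> B \<Longrightarrow>
      assignment_over A f \<Longrightarrow> assignment_over B g \<Longrightarrow> dom f = dom g \<Longrightarrow>
      \<not> separable \<tau> \<Q> n A B f g \<Longrightarrow>
      winning_region \<tau> \<Q> Player_I (Round_Start n Player_II (A, B, f, g))"
  shows "winning_region \<tau> \<Q> Player_I (Quantifier_Chosen n Player_I pos Q x)"
proof -
  define X where "X = {a \<in> Dom M. sat M (h(x \<mapsto> a)) \<phi>}"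
  define Y where "Y = {a \<in> Dom N. sat N (h'(x \<mapsto> a)) \<phi>}"
  \<comment> \<open>Restricted to \<open>Y\<close>, so that \<open>\<phi>\<close> also separates an element of \<open>P\<close> from one outside \<open>Y\<close>.\<close>
  define P where
    "P = {b \<in> Y. \<forall>a \<in> Dom M. separable \<tau> \<Q> n M N (h(x \<mapsto> a)) (h'(x \<mapsto> b))}"
  have same_M: "winning_region \<tau> \<Q> Player_I
      (Round_Start n Player_I (M, M, h(x \<mapsto> u), h(x \<mapsto> u')))"
    if "u \<in> X" "u' \<in> Dom M - X" for u u'
    using that formula models assignments
    by (intro attack assignment_over_upd separableI[of \<phi>]) (auto simp: X_def)
  have same_N: "winning_region \<tau> \<Q> Player_I
      (Round_Start n Player_I (N, N, h'(x \<mapsto> v), h'(x \<mapsto> v')))"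
    if "v \<in> Y" "v' \<in> Dom N - Y" for v v'
    using that formula models assignments
    by (intro attack assignment_over_upd separableI[of \<phi>]) (auto simp: Y_def)
  have element: "winning_region \<tau> \<Q> Player_I
      (Round_Start n Player_I (M, N, h(x \<mapsto> v), h'(x \<mapsto> v')))"
    if "v \<in> X" "v' \<in> Dom N - Y" for v v'
    using that formula models assignments
    by (intro attack assignment_over_upd separableI[of \<phi>]) (auto simp: X_def Y_def)
  have spillover: "winning_region \<tau> \<Q> Player_I
      (Round_Start n Player_I (M, N, h(x \<mapsto> v), h'(x \<mapsto> v')))"
    if "v \<in> Dom M" "v' \<in> P" for v v'
    using that models assignments
    by (intro attack assignment_over_upd) (auto simp: P_def Y_def)
  have answer: "winning_region \<tau> \<Q> Player_I
      (Answer_Chosen n Player_I (M, N, h, h') Q x X P X')" (is "winning_region _ _ _ ?s")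
    if X': "X' \<subseteq> Dom N" "(Dom N, X') \<in> Q" "P \<subseteq> X'" for X'
  proof (cases "X' \<subseteq> Y")
    case False
    then obtain v' where v': "v' \<in> X'" "v' \<in> Dom N - Y" using X' by blast
    have "winning_region \<tau> \<Q> Player_I (Element_Chosen n Player_I (M, N, h, h') Q x X P v')"
    proof (rule winning_region.opponent_move)
      fix t
      assume "move \<Q> (Element_Chosen n Player_I (M, N, h, h') Q x X P v') t"
      then show "winning_region \<tau> \<Q> Player_I t"
      proof cases
        case (choose_witness_element v)
        then show ?thesis using element v' by auto
      next
        case (choose_spillover_element v)
        then show ?thesis using same_N v' by (auto simp: P_def)
      qed
    qed auto
    moreover have "move \<Q> ?s (Element_Chosen n Player_I (M, N, h, h') Q x X P v')"
      using v'(1) by (rule move.choose_element)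
    ultimately show ?thesis
      by (intro winning_region.own_move[of _ ?s]) auto
  next
    case True
    moreover have "X' \<noteq> Y" using no_witness X' unfolding Y_def by blast
    ultimately obtain v' where v': "v' \<in> Y" "v' \<notin> X'" by blast
    then obtain v where v: "v \<in> Dom M" "\<not> separable \<tau> \<Q> n M N (h(x \<mapsto> v)) (h'(x \<mapsto> v'))"
      using X' unfolding P_def by blast
    have v'_dom: "v' \<in> Dom N" using v' unfolding Y_def by blast
    \<comment> \<open>Inseparable elements agree on \<open>\<phi>\<close>, which is true of \<open>v'\<close>.\<close>
    have "v \<in> X"
    proof (rule ccontr)
      assume "v \<notin> X"
      then have "separable \<tau> \<Q> n M N (h(x \<mapsto> v)) (h'(x \<mapsto> v'))"
        using v v' formula assignments by (intro separableI[of \<phi>]) (auto simp: X_def Y_def)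
      with v show False by blast
    qed
    then have "move \<Q> ?s
        (Round_Start n (opponent Player_I) (M, N, h(x \<mapsto> v), h'(x \<mapsto> v')))"
      using v' v'_dom by (intro move.choose_swap) auto
    moreover have "winning_region \<tau> \<Q> Player_I
        (Round_Start n Player_II (M, N, h(x \<mapsto> v), h'(x \<mapsto> v')))"
      using v v'_dom models assignments by (intro defence assignment_over_upd) auto
    ultimately show ?thesis
      by (intro winning_region.own_move[of _ ?s]) auto
  qed
  have "winning_region \<tau> \<Q> Player_I (Spillover_Chosen n Player_I (M, N, h, h') Q x X P)"
  proof (rule winning_region.opponent_move)
    fix t
    assume "move \<Q> (Spillover_Chosen n Player_I (M, N, h, h') Q x X P) t"
    then show "winning_region \<tau> \<Q> Player_I t"
    proof cases
      case (contest_spillover v' v)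
      then show ?thesis using spillover by auto
    next
      case (choose_answer X')
      then show ?thesis using answer by auto
    qed
  qed auto
  moreover have "P \<subseteq> Dom N" unfolding P_def Y_def by blast
  then have "move \<Q> (Witness_Accepted n Player_I (M, N, h, h') Q x X)
      (Spillover_Chosen n Player_I (M, N, h, h') Q x X P)"
    by (rule move.choose_spillover)
  ultimately have accepted:
    "winning_region \<tau> \<Q> Player_I (Witness_Accepted n Player_I (M, N, h, h') Q x X)"
    by (intro winning_region.own_move[of _ "Witness_Accepted n Player_I (M, N, h, h') Q x X"]) auto
  have "winning_region \<tau> \<Q> Player_I (Witness_Chosen n Player_I (M, N, h, h') Q x X)"
  proof (rule winning_region.opponent_move)
    fix t
    assume "move \<Q> (Witness_Chosen n Player_I (M, N, h, h') Q x X) t"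
    then show "winning_region \<tau> \<Q> Player_I t"
    proof cases
      case (contest_witness u u')
      then show ?thesis using same_M by auto
    next
      case accept_witness
      then show ?thesis using accepted by simp
    qed
  qed auto
  moreover have "move \<Q> (Quantifier_Chosen n Player_I pos Q x)
      (Witness_Chosen n Player_I (M, N, h, h') Q x X)"
    using pos witness by (intro move.choose_witness) (auto simp: X_def)
  ultimately show ?thesis
    by (intro winning_region.own_move[of _ "Quantifier_Chosen n Player_I pos Q x"]) auto
qed

theorem lemma3p4:
  fixes \<tau> :: "'r vocabulary"
    and \<Q> :: "'a quant set"
    and d :: nat
    and A B :: "('r, 'a) model"
    and f g :: "'a assignment"
  assumes "finite (dom \<tau>)"
    and "finite \<Q>"
    and "\<And>Q. Q \<in> \<Q> \<Longrightarrow> generalized_quantifier Q"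
    and induction_hypothesis:
      "\<And>(A' :: ('r, 'a) model) (B' :: ('r, 'a) model) f' g'.
         is_model \<tau> A' \<Longrightarrow> is_model \<tau> B' \<Longrightarrow>
         assignment_over A' f' \<Longrightarrow> assignment_over B' g' \<Longrightarrow> dom f' = dom g' \<Longrightarrow>
         player_I_has_winning_strategy \<tau> \<Q> d A' B' f' g' \<longleftrightarrow> separable \<tau> \<Q> d A' B' f' g'"
    and "is_model \<tau> A" and "is_model \<tau> B"
    and "assignment_over A f" and "assignment_over B g"
    and "dom f = dom g"
    and "separable \<tau> \<Q> (Suc d) A B f g"
  shows "player_I_has_winning_strategy \<tau> \<Q> (Suc d) A B f g"
proof -
  have region_iff: "winning_region \<tau> \<Q> Player_I (Round_Start d Player_I (A', B', f', g')) \<longleftrightarrow>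
      separable \<tau> \<Q> d A' B' f' g'"
    if "is_model \<tau> A'" "is_model \<tau> B'" "assignment_over A' f'" "assignment_over B' g'"
      "dom f' = dom g'" for A' B' :: "('r, 'a) model" and f' g'
    using induction_hypothesis[OF that]
    unfolding player_I_has_winning_strategy_def winning_strategy_iff_winning_region .
  have attack: "winning_region \<tau> \<Q> Player_I (Round_Start d Player_I (A', B', f', g'))"
    if "is_model \<tau> A'" "is_model \<tau> B'" "assignment_over A' f'" "assignment_over B' g'"
      "dom f' = dom g'" "separable \<tau> \<Q> d A' B' f' g'"
    for A' B' :: "('r, 'a) model" and f' g'
    using region_iff[OF that(1-5)] that(6) by simp
  have defence: "winning_region \<tau> \<Q> Player_I (Round_Start d Player_II (A', B', f', g'))"
    if "is_model \<tau> A'" "is_model \<tau> B'" "assignment_over A' f'" "assignment_over B' g'"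
      "dom f' = dom g'" "\<not> separable \<tau> \<Q> d A' B' f' g'"
    for A' B' :: "('r, 'a) model" and f' g'
    using defender_wins_if_attacker_loses[of \<tau> \<Q> Player_I d "(A', B', f', g')"]
      region_iff[OF that(1-5)] that(6) by simp
  let ?s = "Round_Start (Suc d) Player_I (A, B, f, g)"
  have "winning_region \<tau> \<Q> Player_I ?s"
  proof (cases "partial_isomorphism \<tau> A B f g")
    case False
    then show ?thesis by (intro winning_region.game_over) simp
  next
    case True
    obtain \<phi> where "\<phi> \<in> FO \<tau> \<Q>" "quantifier_depth \<phi> \<le> Suc d" "free_vars \<phi> \<subseteq> dom f"
      "sat A f \<phi> \<noteq> sat B g \<phi>"
      using \<open>separable \<tau> \<Q> (Suc d) A B f g\<close> unfolding separable_def FO_depth_def by auto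
    from distinguishing_quantifier[OF this(1-3) True this(4)]
    obtain Q x \<psi> where "Q \<in> \<Q>" and \<psi>: "\<psi> \<in> FO_depth \<tau> \<Q> d"
      and free: "free_vars \<psi> \<subseteq> insert x (dom f)"
      and differ: "sat A f (Quant Q x \<psi>) \<noteq> sat B g (Quant Q x \<psi>)" .
    have "winning_region \<tau> \<Q> Player_I (Quantifier_Chosen d Player_I (A, B, f, g) Q x)"
    proof (cases "sat A f (Quant Q x \<psi>)")
      case True
      show ?thesis
        by (rule quantifier_round[of A f x \<psi> Q B g];
            (fact attack | fact defence | use True differ \<psi> free assms(5-9) in simp))
    next
      case False
      show ?thesis
        by (rule quantifier_round[of B g x \<psi> Q A f];
            (fact attack | fact defence | use False differ \<psi> free assms(5-9) in simp))
    qed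
    moreover have "move \<Q> ?s (Quantifier_Chosen d Player_I (A, B, f, g) Q x)"
      using \<open>Q \<in> \<Q>\<close> by (rule move.choose_quantifier)
    ultimately show ?thesis
      using True by (intro winning_region.own_move[of _ ?s]) auto
  qed
  then show ?thesis
    unfolding player_I_has_winning_strategy_def winning_strategy_iff_winning_region .
qed

end
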